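(* The product numerical range need not be convex: there exist positive integers $K,M$ and a linear operator $A$ on $\mathbb{C}^K\otimes\mathbb{C}^M$ such that $\Lambda^{\otimes}(A)$ is not a convex subset of $\mathbb{C}$.
   Context: For an operator $X$ on $\mathbb{C}^K\otimes\mathbb{C}^M$, the product numerical range is $\Lambda^{\otimes}(X)=\{\langle\psi_A\otimes\psi_B|X|\psi_A\otimes\psi_B\rangle : \psi_A\in\mathbb{C}^K,\ \psi_B\in\mathbb{C}^M,\ \|\psi_A\|=\|\psi_B\|=1\}$. *)

theory Defs
  imports
    "HOL-Analysis.Convex"
    "HOL-Analysis.L2_Norm"
    "Jordan_Normal_Form.Matrix"
begin

(* C^n is carrier_vec n.  The tensor product of C^K and C^M is carrier_vec (K * M) through the
   lexicographic (Kronecker) basis: e_i \<otimes> e_j is the unit vector with index i * M + j.  Linear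
   operators on it are the complex matrices in carrier_mat (K * M) (K * M). *)

definition tensor_vec :: "complex vec \<Rightarrow> complex vec \<Rightarrow> complex vec" where
  "tensor_vec u v =
     vec (dim_vec u * dim_vec v) (\<lambda>k. u $ (k div dim_vec v) * v $ (k mod dim_vec v))"

definition cvec_norm :: "complex vec \<Rightarrow> real" where
  "cvec_norm v = L2_set (\<lambda>i. cmod (v $ i)) {..<dim_vec v}"

(* The operation \<bullet>c is conjugate-linear in its second argument, whereas the bra-ket product is
   conjugate-linear in its first, hence the swap. *)
definition braket :: "complex vec \<Rightarrow> complex mat \<Rightarrow> complex vec \<Rightarrow> complex" where
  "braket u X v = (X *\<^sub>v v) \<bullet>c u"

definition product_numerical_range :: "nat \<Rightarrow> nat \<Rightarrow> complex mat \<Rightarrow> complex set" where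
  "product_numerical_range K M X =
     {braket (tensor_vec u v) X (tensor_vec u v) | u v.
        u \<in> carrier_vec K \<and> v \<in> carrier_vec M \<and> cvec_norm u = 1 \<and> cvec_norm v = 1}"

end

(* For the diagonal operator |00><00| + i |11><11| on two qubits, unit product vectors give the
   values p q + i (1 - p) (1 - q) with p, q in [0,1].  Both 1 and i occur, but the midpoint would
   need p + q = 1 and p q = 1/2, contradicting p q <= ((p + q) / 2)^2 = 1/4. *)
theory Submission
  imports Defs
begin

text \<open>With \<open>M = 2\<close>, the indices 0 = 0 * 2 + 0 and 3 = 1 * 2 + 1 belong to the
  basis vectors |00> and |11>.\<close>

definition corner_mat :: "complex mat" where
  "corner_mat = mat 4 4 (\<lambda>(i, j). if i = 0 \<and> j = 0 then 1 else if i = 3 \<and> j = 3 then \<i> else 0)"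

lemma braket_tensor_corner_mat:
  assumes "u \<in> carrier_vec 2" "v \<in> carrier_vec 2"
  shows "braket (tensor_vec u v) corner_mat (tensor_vec u v) =
    Complex ((cmod (u $ 0))\<^sup>2 * (cmod (v $ 0))\<^sup>2) ((cmod (u $ 1))\<^sup>2 * (cmod (v $ 1))\<^sup>2)"
proof -
  have d: "dim_vec u = 2" "dim_vec v = 2"
    using assms by auto
  have s: "{0..<4::nat} = {0, 1, 2, 3}"
    by auto
  have "braket (tensor_vec u v) corner_mat (tensor_vec u v) =
    (u $ 0 * v $ 0) * cnj (u $ 0 * v $ 0) + \<i> * ((u $ 1 * v $ 1) * cnj (u $ 1 * v $ 1))"
    by (simp add: braket_def corner_mat_def tensor_vec_def scalar_prod_def d s)
  then show ?thesis
    \<comment> \<open>Each product \<open>z * cnj z\<close> becomes the real number |z|^2, so the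
      factor \<open>\<i>\<close> separates the real part from the imaginary part.\<close>
    unfolding complex_norm_square[symmetric]
    by (simp add: complex_eq_iff norm_mult power_mult_distrib)
qed

lemma cvec_norm_eq_1_iff:
  assumes "u \<in> carrier_vec 2"
  shows "cvec_norm u = 1 \<longleftrightarrow> (cmod (u $ 0))\<^sup>2 + (cmod (u $ 1))\<^sup>2 = 1"
  using assms by (auto simp: cvec_norm_def L2_set_def numeral_2_eq_2)

text \<open>The values depend on \<open>u\<close> and \<open>v\<close> only through the squared
  moduli of their coordinates. Normalization leaves one free weight in [0,1] per factor:
  \<open>p\<close> for \<open>u\<close> and \<open>q\<close> for \<open>v\<close>.\<close>

lemma product_numerical_range_corner_mat:
  "product_numerical_range 2 2 corner_mat =
     {Complex (p * q) ((1 - p) * (1 - q)) | p q. p \<in> {0..1} \<and> q \<in> {0..1}}"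
proof (intro equalityI subsetI)
  fix z assume "z \<in> product_numerical_range 2 2 corner_mat"
  then obtain u v where uv: "u \<in> carrier_vec 2" "v \<in> carrier_vec 2" "cvec_norm u = 1" "cvec_norm v = 1"
    and z: "z = braket (tensor_vec u v) corner_mat (tensor_vec u v)"
    unfolding product_numerical_range_def by blast
  let ?p = "(cmod (u $ 0))\<^sup>2" and ?q = "(cmod (v $ 0))\<^sup>2"
  have "?p + (cmod (u $ 1))\<^sup>2 = 1" "?q + (cmod (v $ 1))\<^sup>2 = 1"
    using uv by (simp_all add: cvec_norm_eq_1_iff)
  then have *: "(cmod (u $ 1))\<^sup>2 = 1 - ?p" "(cmod (v $ 1))\<^sup>2 = 1 - ?q"
    by simp_all
  have "?p \<in> {0..1}" "?q \<in> {0..1}"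
    using * zero_le_power2[of "cmod (u $ 1)"] zero_le_power2[of "cmod (v $ 1)"] by auto
  moreover have "z = Complex (?p * ?q) ((1 - ?p) * (1 - ?q))"
    unfolding z braket_tensor_corner_mat[OF uv(1,2)] * ..
  ultimately show "z \<in> {Complex (p * q) ((1 - p) * (1 - q)) | p q. p \<in> {0..1} \<and> q \<in> {0..1}}"
    by blast
next
  fix z assume "z \<in> {Complex (p * q) ((1 - p) * (1 - q)) | p q. p \<in> {0..1::real} \<and> q \<in> {0..1}}"
  then obtain p q :: real where pq: "p \<in> {0..1}" "q \<in> {0..1}"
    and z: "z = Complex (p * q) ((1 - p) * (1 - q))"
    by blast
  \<comment> \<open>A real unit vector whose coordinates have squared moduli \<open>r\<close> and
    \<open>1 - r\<close>; both radicands are nonnegative for \<open>r\<close> in [0,1].\<close>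
  define w where "w r = vec 2 (\<lambda>i. complex_of_real (if i = 0 then sqrt r else sqrt (1 - r)))"
    for r :: real
  have w: "w r \<in> carrier_vec 2" "(cmod (w r $ 0))\<^sup>2 = r" "(cmod (w r $ 1))\<^sup>2 = 1 - r"
    if "r \<in> {0..1}" for r
    using that by (auto simp: w_def)
  have "z = braket (tensor_vec (w p) (w q)) corner_mat (tensor_vec (w p) (w q))"
    using pq by (simp only: z braket_tensor_corner_mat w)
  moreover have "cvec_norm (w p) = 1" "cvec_norm (w q) = 1"
    using pq by (simp_all only: cvec_norm_eq_1_iff w)
  ultimately show "z \<in> product_numerical_range 2 2 corner_mat"
    unfolding product_numerical_range_def using w(1) pq by blast
qed

lemma not_convex_product_numerical_range_corner_mat:
  "\<not> convex (product_numerical_range 2 2 corner_mat)"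
proof
  assume "convex (product_numerical_range 2 2 corner_mat)"
  \<comment> \<open>The two endpoints arise from p = q = 1 (the vector |00>) and p = q = 0 (the
    vector |11>).\<close>
  moreover have "Complex 1 0 \<in> product_numerical_range 2 2 corner_mat"
    unfolding product_numerical_range_corner_mat by (intro CollectI exI[of _ 1]) simp
  moreover have "Complex 0 1 \<in> product_numerical_range 2 2 corner_mat"
    unfolding product_numerical_range_corner_mat by (intro CollectI exI[of _ 0]) simp
  ultimately have "(1/2) *\<^sub>R Complex 1 0 + (1/2) *\<^sub>R Complex 0 1 \<in> product_numerical_range 2 2 corner_mat"
    by (rule convexD) simp_all
  then obtain p q :: real where pq: "p * q = 1/2" "(1 - p) * (1 - q) = 1/2"
    unfolding product_numerical_range_corner_mat by (auto simp: complex_eq_iff)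
  \<comment> \<open>Expanding (1 - p) (1 - q) = 1 - (p + q) + p q and inserting p q = 1/2 leaves p +
    q = 1.\<close>
  then have q: "q = 1 - p"
    by (simp add: algebra_simps)
  \<comment> \<open>Completing the square: (2 p - 1)^2 = 1 - 4 p (1 - p), and p (1 - p) = p q =
    1/2.\<close>
  have "(2 * p - 1)\<^sup>2 = -1"
    using pq(1) unfolding q by (simp add: power2_eq_square algebra_simps)
  then show False
    using zero_le_power2[of "2 * p - 1"] by linarith
qed

theorem mainTheorem5:
  shows "\<exists>K M :: nat. K > 0 \<and> M > 0 \<and>
    (\<exists>A \<in> carrier_mat (K * M) (K * M). \<not> convex (product_numerical_range K M A))"
proof (intro exI conjI bexI)
  show "\<not> convex (product_numerical_range 2 2 corner_mat)"
    by (rule not_convex_product_numerical_range_corner_mat)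
  show "corner_mat \<in> carrier_mat (2 * 2) (2 * 2)"
    by (simp add: corner_mat_def)
qed simp_all

end
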